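(* Let $N\ge2$, let $u,u':\mathbb{T}\to\mathbb{T}$ be measurable functions, and let $\pi^u,\pi^{u'}$ be the associated irreducible representations of $\mathcal{O}_N$ on $L^2(\mathbb{T})$. Then the following conditions are equivalent: (i) $\pi^u$ and $\pi^{u'}$ are unitarily equivalent; (ii) the cocycles $u,u'$ cobound, i.e., there exists a measurable function $\Delta:\mathbb{T}\to\mathbb{T}$ such that $$\Delta(z)\,u(z)=u'(z)\,\Delta(z^N)$$ for almost all $z\in\mathbb{T}$.
   Context: $\mathbb{T}$ is the unit circle with normalized Haar measure. The Cuntz algebra $\mathcal{O}_N$ is the $C^*$-algebra generated by $s_0,\dots,s_{N-1}$ with $s_i^*s_j=\delta_{ij}1$ and $\sum_is_is_i^*=1$. Put $A_i=\{e^{2\pi i_0\theta}: i/N\le\theta<(i+1)/N\}$ for $i=0,\dots,N-1$ (where $i_0=\sqrt{-1}$). For measurable $u:\mathbb{T}\to\mathbb{T}$, $\pi^u$ is the representation of $\mathcal{O}_N$ on $L^2(\mathbb{T})$ given by $(\pi^u(s_i)\xi)(z)=\sqrt N\,\chi_{A_i}(z)\,u(z)\,\xi(z^N)$. (Equivalently, identifying $\mathbb{T}$ with $\prod_1^\infty\mathbb{Z}_N$ via $N$-adic expansion of $\theta$, under which $z\mapsto z^N$ becomes the one-sided shift, $(\pi^u(s_i)\xi)(x_1,x_2,\dots)=\sqrt N\delta_{x_1i}u(x_1,x_2,\dots)\xi(x_2,x_3,\dots)$.) *)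

theory Defs
  imports "HOL-Analysis.Analysis"
begin

section \<open>Complex vector spaces, C*-algebras and their representations\<close>

class scaleC =
  fixes scaleC :: "complex \<Rightarrow> 'a \<Rightarrow> 'a" (infixr "*\<^sub>C" 75)

class complex_vector = scaleC + real_vector +
  assumes scaleC_add_right: "c *\<^sub>C (x + y) = c *\<^sub>C x + c *\<^sub>C y"
    and scaleC_add_left: "(c + d) *\<^sub>C x = c *\<^sub>C x + d *\<^sub>C x"
    and scaleC_scaleC: "c *\<^sub>C d *\<^sub>C x = (c * d) *\<^sub>C x"
    and scaleC_one: "1 *\<^sub>C x = x"
    and scaleR_scaleC: "scaleR r x = complex_of_real r *\<^sub>C x"

text \<open>Unital, nonzero complex C*-algebras.\<close>

class cstar_algebra = complex_vector + real_normed_algebra_1 + banach +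
  fixes adj :: "'a \<Rightarrow> 'a"
  assumes mult_scaleC_left: "(c *\<^sub>C x) * y = c *\<^sub>C (x * y)"
    and mult_scaleC_right: "x * (c *\<^sub>C y) = c *\<^sub>C (x * y)"
    and norm_scaleC: "norm (c *\<^sub>C x) = cmod c * norm x"
    and adj_adj: "adj (adj x) = x"
    and adj_add: "adj (x + y) = adj x + adj y"
    and adj_scaleC: "adj (c *\<^sub>C x) = cnj c *\<^sub>C adj x"
    and adj_mult: "adj (x * y) = adj y * adj x"
    and norm_adj_mult_self: "norm (adj x * x) = (norm x)\<^sup>2"

text \<open>Complex inner products, conjugate-linear in the first argument. The underlying real inner
  product is the real part, so that norm and topology are those of the complex inner product.\<close>

class complex_inner = complex_vector + real_inner +
  fixes cinner :: "'a \<Rightarrow> 'a \<Rightarrow> complex"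
  assumes cinner_commute: "cinner x y = cnj (cinner y x)"
    and cinner_add_left: "cinner (x + y) z = cinner x z + cinner y z"
    and cinner_scaleC_left: "cinner (c *\<^sub>C x) y = cnj c * cinner x y"
    and inner_eq_Re_cinner: "inner x y = Re (cinner x y)"

definition cstar_subalgebra :: "'a::cstar_algebra set \<Rightarrow> bool" where
  "cstar_subalgebra B \<longleftrightarrow> closed B \<and> 0 \<in> B \<and>
     (\<forall>x\<in>B. \<forall>y\<in>B. x + y \<in> B \<and> x * y \<in> B) \<and>
     (\<forall>x\<in>B. adj x \<in> B \<and> (\<forall>c. c *\<^sub>C x \<in> B))"

text \<open>The ambient C*-algebra, i.e. the whole type, is the Cuntz algebra with canonical generators
  \<open>s 0, \<dots>, s (N - 1)\<close>. By Cuntz's uniqueness theorem this determines the pair up to isomorphism.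
  The unit lies in the generated C*-subalgebra because of the second relation.\<close>

definition cuntz_algebra :: "nat \<Rightarrow> (nat \<Rightarrow> 'a::cstar_algebra) \<Rightarrow> bool" where
  "cuntz_algebra N s \<longleftrightarrow>
     (\<forall>i<N. \<forall>j<N. adj (s i) * s j = (if i = j then 1 else 0)) \<and>
     (\<Sum>i<N. s i * adj (s i)) = 1 \<and>
     cstar_subalgebra hull (s ` {..<N}) = UNIV"

definition bounded_clinear :: "('h::complex_inner \<Rightarrow> 'k::complex_inner) \<Rightarrow> bool" where
  "bounded_clinear T \<longleftrightarrow> bounded_linear T \<and> (\<forall>c x. T (c *\<^sub>C x) = c *\<^sub>C T x)"

text \<open>Unital *-homomorphisms into the bounded operators on a Hilbert space.\<close>

definition star_representation :: "('a::cstar_algebra \<Rightarrow> 'h::complex_inner \<Rightarrow> 'h) \<Rightarrow> bool" where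
  "star_representation \<pi> \<longleftrightarrow>
     (\<forall>a. bounded_clinear (\<pi> a)) \<and>
     (\<forall>a b x. \<pi> (a + b) x = \<pi> a x + \<pi> b x) \<and>
     (\<forall>c a x. \<pi> (c *\<^sub>C a) x = c *\<^sub>C \<pi> a x) \<and>
     (\<forall>a b x. \<pi> (a * b) x = \<pi> a (\<pi> b x)) \<and>
     (\<forall>x. \<pi> 1 x = x) \<and>
     (\<forall>a x y. cinner (\<pi> (adj a) x) y = cinner x (\<pi> a y))"

definition unitary :: "('h::complex_inner \<Rightarrow> 'k::complex_inner) \<Rightarrow> bool" where
  "unitary W \<longleftrightarrow> bounded_clinear W \<and> bij W \<and> (\<forall>x y. cinner (W x) (W y) = cinner x y)"

definition unitarily_equivalent ::
  "('a::cstar_algebra \<Rightarrow> 'h::complex_inner \<Rightarrow> 'h) \<Rightarrow> ('a \<Rightarrow> 'k::complex_inner \<Rightarrow> 'k) \<Rightarrow> bool" where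
  "unitarily_equivalent \<pi> \<rho> \<longleftrightarrow> (\<exists>W. unitary W \<and> (\<forall>a x. W (\<pi> a x) = \<rho> a (W x)))"


section \<open>The circle and its $L^2$ space\<close>

abbreviation borel_circle :: "complex measure" where
  "borel_circle \<equiv> restrict_space borel (sphere 0 1)"

text \<open>Normalized Haar measure, as the image of Lebesgue measure on \<open>[0, 1)\<close> under
  \<open>\<theta> \<mapsto> exp (2 \<pi> i \<theta>)\<close>.\<close>

definition haar_circle :: "complex measure" where
  "haar_circle = distr (restrict_space lborel {0..<1}) borel_circle (\<lambda>\<theta>. cis (2 * pi * \<theta>))"

lemma measurable_cis_circle [measurable]:
  "(\<lambda>\<theta>. cis (2 * pi * \<theta>)) \<in> restrict_space lborel {0..<1} \<rightarrow>\<^sub>M borel_circle"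
proof -
  have "(\<lambda>\<theta>. cis (2 * pi * \<theta>)) \<in> borel_measurable borel"
    by (intro borel_measurable_continuous_onI continuous_intros)
  then have "(\<lambda>\<theta>. cis (2 * pi * \<theta>)) \<in> borel_measurable lborel"
    by simp
  then show ?thesis
    by (intro measurable_restrict_space1 measurable_restrict_space2) auto
qed

lemma emeasure_haar_circle:
  assumes "X \<in> sets borel_circle"
  shows "emeasure haar_circle X = emeasure lborel {\<theta>\<in>{0..<1}. cis (2 * pi * \<theta>) \<in> X}"
proof -
  have "emeasure haar_circle X = emeasure (restrict_space lborel {0..<1})
      ((\<lambda>\<theta>. cis (2 * pi * \<theta>)) -` X \<inter> {0..<1})"
    unfolding haar_circle_def using assms
    by (subst emeasure_distr) (auto simp: space_restrict_space)
  also have "\<dots> = emeasure lborel {\<theta>\<in>{0..<1}. cis (2 * pi * \<theta>) \<in> X}"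
    by (subst emeasure_restrict_space) (auto intro!: arg_cong[where f = "emeasure lborel"])
  finally show ?thesis .
qed

lemma emeasure_haar_circle_space: "emeasure haar_circle (sphere 0 1) = 1"
proof -
  have "sphere 0 1 \<in> sets borel_circle"
    using sets.top[of borel_circle] by (simp add: space_restrict_space)
  moreover have "{\<theta>\<in>{0..<1::real}. cis (2 * pi * \<theta>) \<in> sphere 0 1} = {0..<1}"
    by auto
  ultimately show ?thesis
    by (simp only: emeasure_haar_circle) simp
qed

definition square_integrable :: "(complex \<Rightarrow> complex) \<Rightarrow> bool" where
  "square_integrable f \<longleftrightarrow>
     f \<in> borel_measurable haar_circle \<and> integrable haar_circle (\<lambda>z. (cmod (f z))\<^sup>2)"

lemma square_integrable_zero: "square_integrable (\<lambda>z. 0)"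
  by (simp add: square_integrable_def)

lemma square_integrable_add:
  assumes "square_integrable f" "square_integrable g"
  shows "square_integrable (\<lambda>z. f z + g z)"
proof -
  have [measurable]: "f \<in> borel_measurable haar_circle" "g \<in> borel_measurable haar_circle"
    using assms by (auto simp: square_integrable_def)
  have "integrable haar_circle (\<lambda>z. (cmod (f z + g z))\<^sup>2)"
  proof (rule Bochner_Integration.integrable_bound)
    show "integrable haar_circle (\<lambda>z. 2 * (cmod (f z))\<^sup>2 + 2 * (cmod (g z))\<^sup>2)"
      using assms by (auto simp: square_integrable_def)
    have "(cmod (a + b))\<^sup>2 \<le> 2 * (cmod a)\<^sup>2 + 2 * (cmod b)\<^sup>2" for a b
    proof -
      have "(cmod (a + b))\<^sup>2 \<le> (cmod a + cmod b)\<^sup>2"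
        by (intro power_mono norm_triangle_ineq) auto
      also have "\<dots> \<le> 2 * (cmod a)\<^sup>2 + 2 * (cmod b)\<^sup>2"
        using sum_squares_bound[of "cmod a" "cmod b"] by (simp add: power2_sum)
      finally show ?thesis .
    qed
    then show "AE z in haar_circle. norm ((cmod (f z + g z))\<^sup>2)
        \<le> norm (2 * (cmod (f z))\<^sup>2 + 2 * (cmod (g z))\<^sup>2)"
      by simp
  qed measurable
  then show ?thesis by (simp add: square_integrable_def)
qed

lemma square_integrable_cmult:
  assumes "square_integrable f"
  shows "square_integrable (\<lambda>z. c * f z)"
  using assms by (auto simp: square_integrable_def norm_mult power_mult_distrib)

lemma integrable_cnj_mult:
  assumes "square_integrable f" "square_integrable g"
  shows "integrable haar_circle (\<lambda>z. cnj (f z) * g z)"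
proof (rule Bochner_Integration.integrable_bound)
  have [measurable]: "f \<in> borel_measurable haar_circle" "g \<in> borel_measurable haar_circle"
    using assms by (auto simp: square_integrable_def)
  show "integrable haar_circle (\<lambda>z. (cmod (f z))\<^sup>2 + (cmod (g z))\<^sup>2)"
    using assms by (auto simp: square_integrable_def)
  have "(\<lambda>z. cnj (f z)) \<in> borel_measurable haar_circle"
    by (rule borel_measurable_continuous_on[OF _ \<open>f \<in> _\<close>]) (intro continuous_intros)
  then show "(\<lambda>z. cnj (f z) * g z) \<in> borel_measurable haar_circle"
    by simp
  have "cmod a * cmod b \<le> (cmod a)\<^sup>2 + (cmod b)\<^sup>2" for a b
    using sum_squares_bound[of "cmod a" "cmod b"]
      mult_nonneg_nonneg[OF norm_ge_zero[of a] norm_ge_zero[of b]]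
    by linarith
  then show "AE z in haar_circle. norm (cnj (f z) * g z)
      \<le> norm ((cmod (f z))\<^sup>2 + (cmod (g z))\<^sup>2)"
    by (simp add: norm_mult)
qed

quotient_type l2_circle = "complex \<Rightarrow> complex" /
  partial: "\<lambda>f g. square_integrable f \<and> square_integrable g \<and> (AE z in haar_circle. f z = g z)"
proof (rule part_equivpI)
  show "\<exists>f. square_integrable f \<and> square_integrable f \<and> (AE z in haar_circle. f z = f z)"
    using square_integrable_zero by auto
qed (auto intro!: sympI transpI)

instantiation l2_circle :: complex_inner
begin

lift_definition zero_l2_circle :: l2_circle is "\<lambda>z. 0"
  by (simp add: square_integrable_zero)

lift_definition plus_l2_circle :: "l2_circle \<Rightarrow> l2_circle \<Rightarrow> l2_circle" is "\<lambda>f g z. f z + g z"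
  by (auto simp: square_integrable_add)

lift_definition scaleC_l2_circle :: "complex \<Rightarrow> l2_circle \<Rightarrow> l2_circle" is "\<lambda>c f z. c * f z"
  by (auto simp: square_integrable_cmult)

lift_definition cinner_l2_circle :: "l2_circle \<Rightarrow> l2_circle \<Rightarrow> complex" is
  "\<lambda>f g. \<integral>z. cnj (f z) * g z \<partial>haar_circle"
proof (clarify, goal_cases)
  case (1 f f' g g')
  have "(\<lambda>z. cnj (f z) * g z) \<in> borel_measurable haar_circle"
    "(\<lambda>z. cnj (f' z) * g' z) \<in> borel_measurable haar_circle"
    using 1 by (auto intro!: borel_measurable_integrable integrable_cnj_mult)
  then show ?case
    using 1 by (intro integral_cong_AE) auto
qed

definition uminus_l2_circle :: "l2_circle \<Rightarrow> l2_circle" where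
  "- x = (- 1) *\<^sub>C (x :: l2_circle)"

definition minus_l2_circle :: "l2_circle \<Rightarrow> l2_circle \<Rightarrow> l2_circle" where
  "x - y = x + - (y :: l2_circle)"

definition scaleR_l2_circle :: "real \<Rightarrow> l2_circle \<Rightarrow> l2_circle" where
  "scaleR r x = complex_of_real r *\<^sub>C (x :: l2_circle)"

definition inner_l2_circle :: "l2_circle \<Rightarrow> l2_circle \<Rightarrow> real" where
  "inner x y = Re (cinner x (y :: l2_circle))"

definition norm_l2_circle :: "l2_circle \<Rightarrow> real" where
  "norm x = sqrt (inner x (x :: l2_circle))"

definition sgn_l2_circle :: "l2_circle \<Rightarrow> l2_circle" where
  "sgn x = scaleR (inverse (norm x)) (x :: l2_circle)"

definition dist_l2_circle :: "l2_circle \<Rightarrow> l2_circle \<Rightarrow> real" where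
  "dist x y = norm (x - y :: l2_circle)"

definition uniformity_l2_circle :: "(l2_circle \<times> l2_circle) filter" where
  "uniformity = (INF e\<in>{0<..}. principal {(x, y). dist x (y :: l2_circle) < e})"

definition open_l2_circle :: "l2_circle set \<Rightarrow> bool" where
  "open U \<longleftrightarrow> (\<forall>x\<in>U. eventually (\<lambda>(x', y). x' = x \<longrightarrow> y \<in> U) (uniformity :: (l2_circle \<times> l2_circle) filter))"

instance
proof -
  have add_assoc: "x + y + z = x + (y + z)" for x y z :: l2_circle
    by transfer (auto simp: add.assoc square_integrable_add)
  have add_commute: "x + y = y + x" for x y :: l2_circle
    by transfer (auto simp: add.commute square_integrable_add)
  have add_zero: "0 + x = x" for x :: l2_circle
    by transfer auto
  have neg: "(- 1) *\<^sub>C x + x = 0" for x :: l2_circle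
    by transfer
      (auto simp: square_integrable_zero intro!: square_integrable_add
        square_integrable_cmult[where c = "- 1", simplified])
  have sc1: "c *\<^sub>C (x + y) = c *\<^sub>C x + c *\<^sub>C y" for c and x y :: l2_circle
    by transfer (auto simp: distrib_left square_integrable_add square_integrable_cmult)
  have sc2: "(c + d) *\<^sub>C x = c *\<^sub>C x + d *\<^sub>C x" for c d and x :: l2_circle
    by transfer (auto simp: distrib_right square_integrable_add square_integrable_cmult)
  have sc3: "c *\<^sub>C d *\<^sub>C x = (c * d) *\<^sub>C x" for c d and x :: l2_circle
    by transfer (auto simp: mult.assoc square_integrable_cmult)
  have sc4: "1 *\<^sub>C x = x" for x :: l2_circle
    by transfer auto
  have ci1: "cinner x y = cnj (cinner y x)" for x y :: l2_circle
    by transfer (simp add: Bochner_Integration.integral_cnj[symmetric] mult.commute del: Bochner_Integration.integral_cnj)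
  have ci2: "cinner (x + y) z = cinner x z + cinner y z" for x y z :: l2_circle
    by transfer (simp add: distrib_right integrable_cnj_mult)
  have ci3: "cinner (c *\<^sub>C x) y = cnj c * cinner x y" for c and x y :: l2_circle
    by transfer (simp add: mult.assoc)
  have ci4: "0 \<le> Re (cinner x x)" for x :: l2_circle
  proof transfer
    fix f :: "complex \<Rightarrow> complex"
    have "(\<integral>z. cnj (f z) * f z \<partial>haar_circle) = (\<integral>z. complex_of_real ((cmod (f z))\<^sup>2) \<partial>haar_circle)"
      by (simp add: complex_norm_square mult.commute del: of_real_power)
    then show "0 \<le> Re (\<integral>z. cnj (f z) * f z \<partial>haar_circle)"
      by (simp del: of_real_power)
  qed
  have ci5: "Re (cinner x x) = 0 \<longleftrightarrow> x = 0" for x :: l2_circle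
  proof transfer
    fix f :: "complex \<Rightarrow> complex"
    assume f: "square_integrable f \<and> square_integrable f \<and> (AE z in haar_circle. f z = f z)"
    have "(\<integral>z. cnj (f z) * f z \<partial>haar_circle) = (\<integral>z. complex_of_real ((cmod (f z))\<^sup>2) \<partial>haar_circle)"
      by (simp add: complex_norm_square mult.commute del: of_real_power)
    moreover have "(\<integral>z. (cmod (f z))\<^sup>2 \<partial>haar_circle) = 0 \<longleftrightarrow> (AE z in haar_circle. (cmod (f z))\<^sup>2 = 0)"
      using f by (intro integral_nonneg_eq_0_iff_AE) (auto simp: square_integrable_def)
    ultimately show "Re (\<integral>z. cnj (f z) * f z \<partial>haar_circle) = 0 \<longleftrightarrow>
        square_integrable f \<and> square_integrable (\<lambda>z. 0) \<and> (AE z in haar_circle. f z = 0)"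
      using f by (simp add: square_integrable_zero del: of_real_power)
  qed
  show "OFCLASS(l2_circle, complex_inner_class)"
  proof
    fix x y z :: l2_circle and r s :: real and c d :: complex and U :: "l2_circle set"
    show "x + y + z = x + (y + z)" by (rule add_assoc)
    show "x + y = y + x" by (rule add_commute)
    show "0 + x = x" by (rule add_zero)
    show "- x + x = 0" by (simp add: uminus_l2_circle_def neg)
    show "x - y = x + - y" by (rule minus_l2_circle_def)
    show "r *\<^sub>R (x + y) = r *\<^sub>R x + r *\<^sub>R y" by (simp add: scaleR_l2_circle_def sc1)
    show "(r + s) *\<^sub>R x = r *\<^sub>R x + s *\<^sub>R x" by (simp add: scaleR_l2_circle_def sc2)
    show "r *\<^sub>R s *\<^sub>R x = (r * s) *\<^sub>R x" by (simp add: scaleR_l2_circle_def sc3)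
    show "1 *\<^sub>R x = x" by (simp add: scaleR_l2_circle_def sc4)
    show "c *\<^sub>C (x + y) = c *\<^sub>C x + c *\<^sub>C y" by (rule sc1)
    show "(c + d) *\<^sub>C x = c *\<^sub>C x + d *\<^sub>C x" by (rule sc2)
    show "c *\<^sub>C d *\<^sub>C x = (c * d) *\<^sub>C x" by (rule sc3)
    show "1 *\<^sub>C x = x" by (rule sc4)
    show "r *\<^sub>R x = complex_of_real r *\<^sub>C x" by (rule scaleR_l2_circle_def)
    show "dist x y = norm (x - y)" by (rule dist_l2_circle_def)
    show "sgn x = inverse (norm x) *\<^sub>R x" by (rule sgn_l2_circle_def)
    show "uniformity = (INF e\<in>{0<..}. principal {(x, y). dist x (y :: l2_circle) < e})"
      by (rule uniformity_l2_circle_def)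
    show "open U \<longleftrightarrow> (\<forall>x\<in>U. \<forall>\<^sub>F (x', y) in uniformity. x' = x \<longrightarrow> y \<in> U)"
      by (rule open_l2_circle_def)
    show "inner x y = inner y x"
      using ci1[of x y] by (simp add: inner_l2_circle_def)
    show "inner (x + y) z = inner x z + inner y z"
      by (simp add: inner_l2_circle_def ci2)
    show "inner (r *\<^sub>R x) y = r * inner x y"
      by (simp add: inner_l2_circle_def scaleR_l2_circle_def ci3)
    show "0 \<le> inner x x"
      by (simp add: inner_l2_circle_def ci4)
    show "inner x x = 0 \<longleftrightarrow> x = 0"
      by (simp add: inner_l2_circle_def ci5)
    show "norm x = sqrt (inner x x)" by (rule norm_l2_circle_def)
    show "cinner x y = cnj (cinner y x)" by (rule ci1)
    show "cinner (x + y) z = cinner x z + cinner y z" by (rule ci2)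
    show "cinner (c *\<^sub>C x) y = cnj c * cinner x y" by (rule ci3)
    show "inner x y = Re (cinner x y)" by (rule inner_l2_circle_def)
  qed
qed

end

text \<open>A square-integrable function representing the given class, unique up to null sets.\<close>

definition l2_fun :: "l2_circle \<Rightarrow> complex \<Rightarrow> complex" where
  "l2_fun \<xi> = rep_l2_circle \<xi>"

lemma square_integrable_l2_fun: "square_integrable (l2_fun \<xi>)"
  using Quotient3_rep_reflp[OF Quotient3_l2_circle, of \<xi>] by (simp add: l2_fun_def)

lemma l2_fun_eq_iff: "\<xi> = \<eta> \<longleftrightarrow> (AE z in haar_circle. l2_fun \<xi> z = l2_fun \<eta> z)"
  using Quotient3_rel_rep[OF Quotient3_l2_circle, of \<xi> \<eta>] square_integrable_l2_fun
  by (auto simp: l2_fun_def)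


section \<open>The representations and cocycles attached to circle-valued functions\<close>

definition circle_arc :: "nat \<Rightarrow> nat \<Rightarrow> complex set" where
  "circle_arc N i = (\<lambda>\<theta>. cis (2 * pi * \<theta>)) ` {real i / real N ..< (real i + 1) / real N}"

text \<open>\<open>\<pi>\<close> is the representation \<open>\<pi>\<^sup>u\<close> of the Cuntz algebra with generators \<open>s\<close>; since the \<open>s i\<close>
  generate, it is determined by its values on them. The displayed formula does not depend on the
  representatives chosen by \<^const>\<open>l2_fun\<close>, because \<open>z \<mapsto> z ^ N\<close> preserves Haar measure.
  Irreducibility holds for every measurable circle-valued \<open>u\<close> and is not part of the definition.\<close>

definition is_pi_rep ::
  "nat \<Rightarrow> (nat \<Rightarrow> 'a::cstar_algebra) \<Rightarrow> (complex \<Rightarrow> complex) \<Rightarrow>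
    ('a \<Rightarrow> l2_circle \<Rightarrow> l2_circle) \<Rightarrow> bool" where
  "is_pi_rep N s u \<pi> \<longleftrightarrow> star_representation \<pi> \<and>
     (\<forall>i<N. \<forall>\<xi>. AE z in haar_circle.
        l2_fun (\<pi> (s i) \<xi>) z =
          complex_of_real (sqrt (real N)) * indicator (circle_arc N i) z * u z * l2_fun \<xi> (z ^ N))"

definition cobound :: "nat \<Rightarrow> (complex \<Rightarrow> complex) \<Rightarrow> (complex \<Rightarrow> complex) \<Rightarrow> bool" where
  "cobound N u u' \<longleftrightarrow>
     (\<exists>\<Delta> \<in> borel_circle \<rightarrow>\<^sub>M borel_circle.
        AE z in haar_circle. \<Delta> z * u z = u' z * \<Delta> (z ^ N))"

end

theory Submission
  imports Defs
begin

text \<open>Cutting down to an \<open>N\<close>-adic arc is the image, under both representations, of one and the same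
  projection \<open>s\<^sub>\<alpha> s\<^sub>\<alpha>\<^sup>*\<close>. Hence a unitary intertwiner \<open>W\<close> preserves the integral of \<open>cnj \<xi> \<eta>\<close> over
  every such arc, and as these generate the Borel sets, \<open>cnj (W \<xi>) (W \<eta>) = cnj \<xi> \<eta>\<close> almost
  everywhere. Taking \<open>\<xi> = 1\<close> shows that \<open>W\<close> is multiplication by the unimodular function
  \<open>\<Delta> = W 1\<close>, and applying the intertwining relation for the \<open>s i\<close> to \<open>1\<close> is the cobounding equation.
  Conversely, multiplication by \<open>\<Delta>\<close> intertwines the generators, and this extends to the whole
  Cuntz algebra because *-representations are contractive.\<close>

section \<open>Representations of C*-algebras\<close>

text \<open>The geometric series is an inverse. A left inverse is what later yields a lower bound:
  it recovers a vector from its image under \<open>1 - x\<close>.\<close>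

lemma neumann_left_inverse:
  fixes x :: "'a::{real_normed_algebra_1,banach}"
  assumes "norm x < 1"
  obtains c where "c * (1 - x) = 1"
proof
  have s: "summable (\<lambda>n. x ^ n)"
    using assms by (rule complete_algebra_summable_geometric)
  have "(\<Sum>n. x ^ n) * x = (\<Sum>n. x ^ Suc n)"
    using s by (simp add: suminf_mult2 power_Suc2 del: power_Suc)
  also have "\<dots> = (\<Sum>n. x ^ n) - 1"
    using suminf_split_head[OF s] by simp
  finally show "(\<Sum>n. x ^ n) * (1 - x) = 1"
    by (simp add: right_diff_distrib)
qed

context
  fixes \<pi> :: "'a::cstar_algebra \<Rightarrow> 'h::complex_inner \<Rightarrow> 'h"
  assumes \<pi>: "star_representation \<pi>"
begin

lemma star_representation_bounded_linear: "bounded_linear (\<pi> a)"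
  using \<pi> by (simp add: star_representation_def bounded_clinear_def)

lemma star_representation_add: "\<pi> (a + b) x = \<pi> a x + \<pi> b x"
  using \<pi> by (simp add: star_representation_def)

lemma star_representation_scaleC: "\<pi> (c *\<^sub>C a) x = c *\<^sub>C \<pi> a x"
  using \<pi> by (simp add: star_representation_def)

lemma star_representation_mult: "\<pi> (a * b) x = \<pi> a (\<pi> b x)"
  using \<pi> by (simp add: star_representation_def)

lemma star_representation_one: "\<pi> 1 x = x"
  using \<pi> by (simp add: star_representation_def)

lemma star_representation_adj: "cinner (\<pi> (adj a) x) y = cinner x (\<pi> a y)"
  using \<pi> by (simp add: star_representation_def)

lemma star_representation_linear_left: "linear (\<lambda>a. \<pi> a x)"
  by (rule linearI)
    (simp_all add: star_representation_add star_representation_scaleC scaleR_scaleC)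

lemmas star_representation_zero = linear_0[OF star_representation_linear_left]
  and star_representation_diff = linear_diff[OF star_representation_linear_left]
  and star_representation_scaleR = linear_scale[OF star_representation_linear_left]
  and star_representation_sum = linear_sum[OF star_representation_linear_left]

text \<open>The square of the left side is an inner product with \<open>x\<close>; Cauchy-Schwarz
  leaves one factor to cancel. Since \<open>'h\<close> need not be complete, the estimate goes
  through inner products and not through Hilbert space adjoints.\<close>

lemma star_representation_adj_norm_le: "norm (\<pi> (adj a) x) \<le> onorm (\<pi> a) * norm x"
proof (cases "\<pi> (adj a) x = 0")
  case False
  have "norm (\<pi> (adj a) x) * norm (\<pi> (adj a) x) = inner x (\<pi> a (\<pi> (adj a) x))"
    unfolding power2_eq_square[symmetric] power2_norm_eq_inner inner_eq_Re_cinner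
      star_representation_adj ..
  also have "\<dots> \<le> norm x * norm (\<pi> a (\<pi> (adj a) x))"
    by (rule norm_cauchy_schwarz)
  also have "\<dots> \<le> norm x * (onorm (\<pi> a) * norm (\<pi> (adj a) x))"
    by (intro mult_left_mono onorm star_representation_bounded_linear) simp
  finally have "norm (\<pi> (adj a) x) * norm (\<pi> (adj a) x)
      \<le> (onorm (\<pi> a) * norm x) * norm (\<pi> (adj a) x)"
    by (simp only: ac_simps)
  then show ?thesis
    by (rule mult_right_le_imp_le) (use False in simp)
qed (simp add: onorm_pos_le star_representation_bounded_linear)

text \<open>If \<open>M = \<parallel>\<pi> a\<parallel> > \<parallel>a\<parallel>\<close>, then \<open>1 - a\<^sup>* a / M\<^sup>2\<close> is invertible, so its image is bounded
  below; but vectors almost attaining the norm of \<open>\<pi> a\<close> are almost annihilated by that image.\<close>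

lemma star_representation_contractive: "norm (\<pi> a x) \<le> norm a * norm x"
proof -
  define M where "M = onorm (\<pi> a)"
  have le: "norm (\<pi> a y) \<le> M * norm y" for y
    unfolding M_def by (intro onorm star_representation_bounded_linear)
  have "M \<le> norm a"
  proof (rule ccontr)
    assume "\<not> M \<le> norm a"
    then have M: "norm a < M" by simp
    then have M0: "M > 0" by (meson norm_ge_zero order_le_less_trans)
    have "norm (adj a * a) < M\<^sup>2"
      using M by (simp add: norm_adj_mult_self power_strict_mono)
    then have "norm ((1 / M\<^sup>2) *\<^sub>R (adj a * a)) < 1"
      using M0 by (simp add: divide_simps)
    then obtain c where c: "c * (1 - (1 / M\<^sup>2) *\<^sub>R (adj a * a)) = 1"
      by (rule neumann_left_inverse)
    obtain K0 where K0: "\<And>y. norm (\<pi> c y) \<le> norm y * K0"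
      using bounded_linear.bounded[OF star_representation_bounded_linear] by blast
    \<comment> \<open>Raising the bound to at least 1 keeps \<open>1 - 1 / K\<^sup>2\<close>
      nonnegative, as the square root below requires.\<close>
    define K where "K = max 1 K0"
    have K: "K \<ge> 1" "\<And>y. norm (\<pi> c y) \<le> norm y * K"
      using K0 by (auto simp: K_def intro: order_trans[OF K0 mult_left_mono])
    \<comment> \<open>The factor is strictly below \<open>M\<close>. The left inverse bounds
      \<open>norm y\<close> by \<open>K\<close> times the norm of \<open>y - T / M\<^sup>2\<close>;
      in the expanded square the cross term contributes minus twice
      \<open>(norm (\<pi> a y))\<^sup>2 / M\<^sup>2\<close> and the last term at most once that
      amount.\<close>
    have bd: "norm (\<pi> a y) \<le> M * sqrt (1 - 1 / K\<^sup>2) * norm y" for y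
    proof -
      define T where "T = \<pi> (adj a) (\<pi> a y)"
      have "y = \<pi> c (y - (1 / M\<^sup>2) *\<^sub>R T)"
        using star_representation_mult[of c "1 - (1 / M\<^sup>2) *\<^sub>R (adj a * a)" y]
        unfolding c T_def star_representation_diff star_representation_scaleR
          star_representation_mult star_representation_one .
      then have "norm y \<le> norm (y - (1 / M\<^sup>2) *\<^sub>R T) * K"
        using K(2) by metis
      then have "(norm y)\<^sup>2 \<le> (norm (y - (1 / M\<^sup>2) *\<^sub>R T))\<^sup>2 * K\<^sup>2"
        unfolding power_mult_distrib[symmetric] by (intro power_mono) auto
      also have "(norm (y - (1 / M\<^sup>2) *\<^sub>R T))\<^sup>2
          = (norm y)\<^sup>2 - 2 / M\<^sup>2 * inner T y + (norm T)\<^sup>2 / M ^ 4"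
        unfolding power2_norm_eq_inner
        by (simp add: inner_diff_left inner_diff_right inner_commute
            power2_eq_square power4_eq_xxxx)
      also have "inner T y = (norm (\<pi> a y))\<^sup>2"
        unfolding T_def inner_eq_Re_cinner star_representation_adj power2_norm_eq_inner ..
      also have "(norm T)\<^sup>2 / M ^ 4 \<le> (norm (\<pi> a y))\<^sup>2 / M\<^sup>2"
      proof -
        have "(norm T)\<^sup>2 \<le> (M * norm (\<pi> a y))\<^sup>2"
          unfolding T_def M_def by (intro power_mono star_representation_adj_norm_le) simp
        then show ?thesis
          using M0 by (simp add: field_simps power2_eq_square power4_eq_xxxx)
      qed
      finally have "(norm y)\<^sup>2 \<le> ((norm y)\<^sup>2 - (norm (\<pi> a y))\<^sup>2 / M\<^sup>2) * K\<^sup>2"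
        using K(1) by (simp add: mult_right_mono)
      then have *: "(norm (\<pi> a y))\<^sup>2 \<le> M\<^sup>2 * (1 - 1 / K\<^sup>2) * (norm y)\<^sup>2"
        using M0 K(1) by (simp add: field_simps)
      then have "norm (\<pi> a y) \<le> sqrt (M\<^sup>2 * (1 - 1 / K\<^sup>2) * (norm y)\<^sup>2)"
        by (rule real_le_rsqrt)
      then show ?thesis
        using M0 by (simp add: real_sqrt_mult)
    qed
    have "M \<le> M * sqrt (1 - 1 / K\<^sup>2)"
      unfolding M_def by (rule onorm_bound) (use bd M0 K(1) in \<open>simp_all flip: M_def\<close>)
    then show False
      using M0 K(1) by simp
  qed
  then show ?thesis
    using le[of x] by (meson mult_right_mono norm_ge_zero order_trans)
qed

end

section \<open>From the generators to the whole algebra\<close>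

lemma cinner_extensionality:
  fixes x y :: "'h::complex_inner"
  assumes "\<And>z. cinner x z = cinner y z"
  shows "x = y"
proof -
  have "inner (x - y) z = 0" for z
    using assms[of z] by (simp add: inner_diff_left) (simp add: inner_eq_Re_cinner)
  then show ?thesis
    by (metis inner_eq_zero_iff right_minus_eq)
qed

text \<open>The elements on which the relation holds form a C*-subalgebra containing
  \<open>G\<close>. Contractivity of both representations gives closedness, unitarity of
  \<open>W\<close> gives stability under adjoints.\<close>

lemma unitary_intertwines_generated:
  fixes \<pi> :: "'a::cstar_algebra \<Rightarrow> 'h::complex_inner \<Rightarrow> 'h"
    and \<rho> :: "'a \<Rightarrow> 'k::complex_inner \<Rightarrow> 'k"
  assumes \<pi>: "star_representation \<pi>" and \<rho>: "star_representation \<rho>" and W: "unitary W"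
    and gen: "cstar_subalgebra hull G = UNIV"
    and G: "\<And>g x. g \<in> G \<Longrightarrow> W (\<pi> g x) = \<rho> g (W x)"
  shows "W (\<pi> a x) = \<rho> a (W x)"
proof -
  have lin: "bounded_linear W" and scale: "W (c *\<^sub>C x) = c *\<^sub>C W x"
    and W_inner: "cinner (W x) (W y) = cinner x y" and "surj W" for c x y
    using W by (auto simp: unitary_def bounded_clinear_def bij_def)
  let ?B = "{a. \<forall>x. W (\<pi> a x) = \<rho> a (W x)}"
  have "closed ?B"
  proof -
    \<comment> \<open>Contractivity makes evaluation at a fixed vector bounded linear in the algebra
      element, with constant \<open>norm x\<close>.\<close>
    have cont: "continuous_on UNIV (\<lambda>a. \<sigma> a x)"
      if "star_representation \<sigma>" for \<sigma> :: "'a \<Rightarrow> 'l::complex_inner \<Rightarrow> 'l" and x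
    proof (rule linear_continuous_on, rule bounded_linear_intro)
      show "norm (\<sigma> a x) \<le> norm a * norm x" for a
        using that by (rule star_representation_contractive)
    qed (simp_all add: star_representation_add[OF that] star_representation_scaleR[OF that])
    have "closed {a. W (\<pi> a x) = \<rho> a (W x)}" for x
      by (intro closed_Collect_eq bounded_linear.continuous_on[OF lin] cont \<pi> \<rho>)
    then show ?thesis
      by (rule closed_Collect_all)
  qed
  moreover have "adj a \<in> ?B" if "a \<in> ?B" for a
  proof (clarify, rule cinner_extensionality)
    fix x z
    \<comment> \<open>Surjectivity lets every test vector be taken as \<open>W y\<close>, so that
      the relation for \<open>a\<close> applies once the adjoint is moved across.\<close>
    obtain y where z: "z = W y" using \<open>surj W\<close> by (metis surj_def)
    have "cinner (W (\<pi> (adj a) x)) z = cinner (W x) (W (\<pi> a y))"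
      by (simp add: z W_inner star_representation_adj[OF \<pi>])
    then show "cinner (W (\<pi> (adj a) x)) z = cinner (\<rho> (adj a) (W x)) z"
      using that by (simp add: z star_representation_adj[OF \<rho>])
  qed
  ultimately have "cstar_subalgebra ?B"
    by (auto simp: cstar_subalgebra_def scale linear_0[OF bounded_linear.linear[OF lin]]
        linear_add[OF bounded_linear.linear[OF lin]]
        star_representation_zero[OF \<pi>] star_representation_zero[OF \<rho>]
        star_representation_add[OF \<pi>] star_representation_add[OF \<rho>]
        star_representation_mult[OF \<pi>] star_representation_mult[OF \<rho>]
        star_representation_scaleC[OF \<pi>] star_representation_scaleC[OF \<rho>])
  then have "cstar_subalgebra hull G \<subseteq> ?B"
    by (intro hull_minimal) (use G in auto)
  with gen show ?thesis by auto
qed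

section \<open>Vanishing integrals\<close>

text \<open>Real and imaginary parts each have the same integrals over measurable sets as the zero
  function, so uniqueness of densities applies.\<close>

lemma AE_eq_0_if_set_integral_0:
  fixes h :: "'a \<Rightarrow> complex"
  assumes h: "integrable M h" and 0: "\<And>X. X \<in> sets M \<Longrightarrow> (\<integral>x. indicator X x * h x \<partial>M) = 0"
  shows "AE x in M. h x = 0"
proof -
  have *: "AE x in M. f x = 0"
    if f: "integrable M f" and f0: "\<And>X. X \<in> sets M \<Longrightarrow> (\<integral>x. indicator X x * f x \<partial>M) = 0"
    for f :: "'a \<Rightarrow> real"
    using density_unique_real[OF f integrable_zero] f0
    by (simp add: set_lebesgue_integral_def)
  have ind: "indicator X x * h x = complex_of_real (indicator X x) * h x" for X x
    by (simp add: indicator_def)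
  have i: "integrable M (\<lambda>x. indicator X x * h x)" if "X \<in> sets M" for X
    using integrable_mult_indicator[OF that h] by (simp add: ind scaleR_conv_of_real)
  have "AE x in M. Re (h x) = 0"
  proof (rule *)
    show "(\<integral>x. indicator X x * Re (h x) \<partial>M) = 0" if X: "X \<in> sets M" for X
      using integral_Re[OF i[OF X]] 0[OF X] by (simp add: ind)
  qed (use h in simp)
  moreover have "AE x in M. Im (h x) = 0"
  proof (rule *)
    show "(\<integral>x. indicator X x * Im (h x) \<partial>M) = 0" if X: "X \<in> sets M" for X
      using integral_Im[OF i[OF X]] 0[OF X] by (simp add: ind)
  qed (use h in simp)
  ultimately show ?thesis
    by eventually_elim (simp add: complex_eq_iff)
qed

text \<open>Dynkin's argument: the sets with vanishing integral are closed under complements, as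
  \<open>space M\<close> is among them, and under countable disjoint unions.\<close>

lemma integral_zero_sigma_sets:
  fixes h :: "'a \<Rightarrow> complex"
  assumes h: "integrable M h" and "Int_stable E" "E \<subseteq> sets M" "space M \<in> E"
    and E0: "\<And>X. X \<in> E \<Longrightarrow> (\<integral>x. indicator X x * h x \<partial>M) = 0"
    and X: "X \<in> sigma_sets (space M) E"
  shows "(\<integral>x. indicator X x * h x \<partial>M) = 0"
proof -
  have ind: "indicator X x * h x = indicat_real X x *\<^sub>R h x" for X x
    by (simp add: indicator_def)
  have EP: "E \<subseteq> Pow (space M)"
    using assms(3) sets.sets_into_space by blast
  have M: "sigma_sets (space M) E \<subseteq> sets M"
    using assms(3) by (rule sets.sigma_sets_subset)
  have i: "integrable M (\<lambda>x. indicator X x * h x)" if "X \<in> sets M" for X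
    using integrable_mult_indicator[OF that h] by (simp add: ind)
  show ?thesis
    using assms(2) EP X
  proof (induction rule: sigma_sets_induct_disjoint)
    case (basic A)
    then show ?case by (rule E0)
  next
    case empty
    then show ?case by simp
  next
    case (compl A)
    have "(\<integral>x. indicator (space M - A) x * h x \<partial>M)
        = (\<integral>x. indicator (space M) x * h x - indicator A x * h x \<partial>M)"
      by (rule Bochner_Integration.integral_cong) (auto simp: indicator_def)
    also have "\<dots> = (\<integral>x. indicator (space M) x * h x \<partial>M) - (\<integral>x. indicator A x * h x \<partial>M)"
      using compl M by (intro Bochner_Integration.integral_diff i) auto
    finally show ?case
      using compl E0[OF assms(4)] by simp
  next
    case (union A)
    have "(\<integral>x. indicator (\<Union>i. A i) x * h x \<partial>M) = (LINT x:(\<Union>i. A i)|M. h x)"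
      by (simp add: set_lebesgue_integral_def ind)
    also have "\<dots> = (\<Sum>i. (LINT x:A i|M. h x))"
    proof (rule lebesgue_integral_countable_add)
      show "A i \<in> sets M" for i
        using union(2) M by auto
      then have "(\<Union>i. A i) \<in> sets M"
        by auto
      then show "set_integrable M (\<Union>i. A i) h"
        using i by (simp add: set_integrable_def ind)
    qed (use union(1) in \<open>auto simp: disjoint_family_on_def\<close>)
    also have "\<dots> = 0"
      using union(3) by (simp add: set_lebesgue_integral_def ind)
    finally show ?case .
  qed
qed

section \<open>Null sets of the circle\<close>

lemma sets_haar_circle [measurable_cong, simp]: "sets haar_circle = sets borel_circle"
  by (simp add: haar_circle_def)

lemma space_haar_circle [simp]: "space haar_circle = sphere 0 1"
  by (simp add: haar_circle_def space_restrict_space)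

lemma sets_borel_circle: "X \<in> sets borel_circle \<longleftrightarrow> X \<in> sets borel \<and> X \<subseteq> sphere 0 1"
  by (subst sets_restrict_space_iff) auto

lemma finite_measure_haar_circle: "finite_measure haar_circle"
  by standard (simp add: emeasure_haar_circle_space)

text \<open>Nullity is moved to the angular coordinate, where Lebesgue measure allows affine
  substitutions.\<close>

lemma emeasure_haar_circle_eq_0_iff:
  assumes "X \<in> sets borel_circle"
  shows "emeasure haar_circle X = 0 \<longleftrightarrow> (AE \<theta> in lborel. \<theta> \<in> {0..<1} \<longrightarrow> cis (2 * pi * \<theta>) \<notin> X)"
proof -
  have [measurable]: "X \<in> sets borel"
    using assms by (simp add: sets_borel_circle)
  have [measurable]: "(\<lambda>\<theta>. cis (2 * pi * \<theta>)) \<in> borel_measurable borel"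
    by (intro borel_measurable_continuous_onI continuous_intros)
  show ?thesis
    unfolding emeasure_haar_circle[OF assms]
    by (subst AE_iff_measurable[OF _ refl]) (auto intro!: arg_cong[where f = "emeasure lborel"])
qed

text \<open>Subtracting \<open>i\<close> whole turns changes nothing, and a suitable
  \<open>i\<close> brings the multiplied angle back into [0, 1).\<close>

lemma cis_power_shift: "cis (2 * pi * t) ^ N = cis (2 * pi * (real N * t - real i))"
proof -
  have "cis (2 * pi * (real N * t - real i)) = cis (real N * (2 * pi * t)) / cis (real i * (2 * pi))"
    by (simp add: cis_divide algebra_simps)
  also have "\<dots> = cis (2 * pi * t) ^ N / cis (2 * pi) ^ i"
    by (simp only: Complex.DeMoivre)
  finally show ?thesis
    by (simp only: cis_2pi power_one div_by_1)
qed

text \<open>On each of the \<open>N\<close> arcs, the power map is \<open>\<theta> \<mapsto> N \<theta> - i\<close> in the angular coordinate.\<close>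

lemma AE_haar_circle_power:
  assumes N: "N > 0" and P: "AE z in haar_circle. P z"
  shows "AE z in haar_circle. P (z ^ N)"
proof -
  from P obtain X where X: "{z \<in> sphere 0 1. \<not> P z} \<subseteq> X" "emeasure haar_circle X = 0"
    "X \<in> sets borel_circle"
    by (auto elim!: AE_E)
  let ?Y = "{z \<in> sphere 0 1. z ^ N \<in> X}"
  have [measurable]: "X \<in> sets borel"
    using X(3) by (simp add: sets_borel_circle)
  have [measurable]: "(\<lambda>\<theta>. cis (2 * pi * \<theta>)) \<in> borel_measurable borel"
    by (intro borel_measurable_continuous_onI continuous_intros)
  have "{z. z \<in> sphere 0 1 \<and> z ^ N \<in> X} \<in> sets borel"
    by measurable
  then have Y: "?Y \<in> sets borel_circle"
    by (auto simp: sets_borel_circle)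
  \<comment> \<open>Affine maps of nonzero slope pull Lebesgue null sets back to null sets.\<close>
  have "AE \<theta> in lborel. - real i + real N * \<theta> \<in> {0..<1} \<longrightarrow> cis (2 * pi * (- real i + real N * \<theta>)) \<notin> X"
    for i
    by (rule AE_borel_affine) (use N X emeasure_haar_circle_eq_0_iff[OF X(3)] in auto)
  \<comment> \<open>The index will depend on \<open>\<theta>\<close>, so the countably many
    exceptional sets are merged first.\<close>
  then have "AE \<theta> in lborel. \<forall>i. - real i + real N * \<theta> \<in> {0..<1} \<longrightarrow>
      cis (2 * pi * (- real i + real N * \<theta>)) \<notin> X"
    by (simp add: AE_all_countable)
  then have "AE \<theta> in lborel. \<theta> \<in> {0..<1} \<longrightarrow> cis (2 * pi * \<theta>) \<notin> ?Y"
  proof (eventually_elim, intro impI)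
    fix \<theta> :: real
    assume *: "\<forall>i. - real i + real N * \<theta> \<in> {0..<1} \<longrightarrow> cis (2 * pi * (- real i + real N * \<theta>)) \<notin> X"
      and \<theta>: "\<theta> \<in> {0..<1}"
    \<comment> \<open>With the integer part of \<open>N * \<theta>\<close>, what is left is the
      fractional part.\<close>
    define i where "i = nat \<lfloor>real N * \<theta>\<rfloor>"
    have i: "real i = of_int \<lfloor>real N * \<theta>\<rfloor>"
      using \<theta> by (simp add: i_def)
    have "cis (2 * pi * (- real i + real N * \<theta>)) \<notin> X"
      using *[rule_format, of i] unfolding i by simp linarith
    then show "cis (2 * pi * \<theta>) \<notin> ?Y"
      using cis_power_shift[of \<theta> N i] by simp
  qed
  then have "emeasure haar_circle ?Y = 0"
    using emeasure_haar_circle_eq_0_iff[OF Y] by simp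
  then have "?Y \<in> null_sets haar_circle"
    using Y by auto
  then show ?thesis
    by (rule AE_I') (use X(1) in \<open>auto simp: norm_power\<close>)
qed

section \<open>Arcs of the circle\<close>

text \<open>On the circle, this inverts the parametrization
  \<open>\<theta> \<mapsto> cis (2 * pi * \<theta>)\<close> of [0, 1).\<close>

definition angle :: "complex \<Rightarrow> real" where
  "angle z = Arg2pi z / (2 * pi)"

lemma angle_bounds: "0 \<le> angle z" "angle z < 1"
  using Arg2pi[of z] by (auto simp: angle_def field_simps)

lemma cis_angle: "z \<in> sphere 0 1 \<Longrightarrow> cis (2 * pi * angle z) = z"
  using Arg2pi_eq[of z] by (simp add: angle_def cis_conv_exp)

lemma angle_cis: "0 \<le> t \<Longrightarrow> t < 1 \<Longrightarrow> angle (cis (2 * pi * t)) = t"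
  unfolding angle_def
  by (subst Arg2pi_unique[of 1 "2 * pi * t"]) (auto simp: cis_conv_exp)

text \<open>On N-adic expansions of the angle this is the one-sided shift: \<open>i\<close> is the
  leading digit, which multiplication by \<open>N\<close> turns into the integer part.\<close>

lemma angle_power:
  assumes z: "z \<in> sphere 0 1" and i: "real i \<le> real N * angle z" "real N * angle z < real i + 1"
  shows "angle (z ^ N) = real N * angle z - real i"
proof -
  have "z ^ N = cis (2 * pi * (real N * angle z - real i))"
    using cis_angle[OF z] cis_power_shift[of "angle z" N i] by simp
  then show ?thesis
    using i by (simp add: angle_cis)
qed

text \<open>Cylinder sets: for \<open>k < N ^ n\<close>, the first \<open>n\<close> N-adic digits of
  the angle spell \<open>k\<close>.\<close>

definition adic_arc :: "nat \<Rightarrow> nat \<Rightarrow> nat \<Rightarrow> complex set" where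
  "adic_arc N n k = {z \<in> sphere 0 1. real k \<le> real N ^ n * angle z \<and> real N ^ n * angle z < real k + 1}"

lemma adic_arc_0: "adic_arc N 0 0 = sphere 0 1"
  using angle_bounds by (auto simp: adic_arc_def)

text \<open>\<open>i < N\<close> keeps the parameter interval inside [0, 1), where
  \<open>angle\<close> recovers the parameter.\<close>

lemma circle_arc_eq:
  assumes "i < N"
  shows "circle_arc N i = {z \<in> sphere 0 1. real i \<le> real N * angle z \<and> real N * angle z < real i + 1}"
proof (intro set_eqI iffI)
  fix z assume "z \<in> circle_arc N i"
  then obtain t where t: "real i / real N \<le> t" "t < (real i + 1) / real N" "z = cis (2 * pi * t)"
    by (auto simp: circle_arc_def)
  have "0 \<le> t" using t(1) by (meson divide_nonneg_nonneg of_nat_0_le_iff order_trans)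
  moreover have "(real i + 1) / real N \<le> 1"
    using assms by (simp add: field_simps)
  ultimately have "angle z = t"
    using t by (simp add: angle_cis)
  then show "z \<in> {z \<in> sphere 0 1. real i \<le> real N * angle z \<and> real N * angle z < real i + 1}"
    using t assms by (auto simp: field_simps)
next
  fix z assume z: "z \<in> {z \<in> sphere 0 1. real i \<le> real N * angle z \<and> real N * angle z < real i + 1}"
  then show "z \<in> circle_arc N i"
    unfolding circle_arc_def using assms cis_angle[of z]
    by (intro image_eqI[where x = "angle z"]) (auto simp: field_simps)
qed

text \<open>Of the \<open>n + 1\<close> digits of \<open>j\<close>, the quotient is the leading one
  and the remainder is the word of the others; the power map drops the leading digit.\<close>

lemma adic_arc_Suc:
  assumes N: "N > 0" and j: "j < N ^ Suc n"
  shows "adic_arc N (Suc n) j =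
    circle_arc N (j div N ^ n) \<inter> (\<lambda>z. z ^ N) -` adic_arc N n (j mod N ^ n)"
proof -
  define i k where "i = j div N ^ n" and "k = j mod N ^ n"
  have "i < N"
    using j by (simp add: i_def less_mult_imp_div_less)
  have "k < N ^ n"
    using N by (simp add: k_def)
  then have k1: "real k + 1 \<le> real N ^ n"
    by (metis of_nat_power of_nat_Suc of_nat_le_iff Suc_leI add.commute)
  have "j = i * N ^ n + k"
    unfolding i_def k_def by (rule div_mult_mod_eq[symmetric])
  then have j: "real j = real i * real N ^ n + real k"
    by simp
  have pos: "real N ^ n > 0"
    using N by simp
  have "z \<in> adic_arc N (Suc n) j \<longleftrightarrow> z \<in> circle_arc N i \<and> z ^ N \<in> adic_arc N n k" for z
  proof (cases "z \<in> circle_arc N i")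
    case True
    then have z: "z \<in> sphere 0 1" "real i \<le> real N * angle z" "real N * angle z < real i + 1"
      by (auto simp: circle_arc_eq[OF \<open>i < N\<close>])
    then show ?thesis
      using True by (auto simp: adic_arc_def angle_power j algebra_simps norm_power)
  next
    case False
    have "z \<notin> adic_arc N (Suc n) j"
    proof
      \<comment> \<open>As \<open>k + 1\<close> is at most \<open>N ^ n\<close>, the arc ends no
        later than the arc of its leading digit \<open>i\<close>.\<close>
      assume "z \<in> adic_arc N (Suc n) j"
      then have z: "z \<in> sphere 0 1"
        "real i * real N ^ n \<le> (real N * angle z) * real N ^ n"
        "(real N * angle z) * real N ^ n < (real i + 1) * real N ^ n"
        using k1 by (auto simp: adic_arc_def j algebra_simps)
      then have "z \<in> circle_arc N i"
        using pos by (simp add: circle_arc_eq[OF \<open>i < N\<close>])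
      with False show False ..
    qed
    with False show ?thesis by simp
  qed
  then show ?thesis
    by (auto simp: i_def k_def)
qed

section \<open>The arcs as a Borel partition of the circle\<close>

lemma circle_arc_cover:
  assumes "N > 0" "z \<in> sphere 0 1"
  obtains i where "i < N" "z \<in> circle_arc N i"
proof -
  define i where "i = nat \<lfloor>real N * angle z\<rfloor>"
  have i: "real i = of_int \<lfloor>real N * angle z\<rfloor>"
    by (simp add: i_def angle_bounds)
  have "real i \<le> real N * angle z" "real N * angle z < real i + 1"
    unfolding i by linarith+
  moreover from this have "real i < real N * 1"
    using assms angle_bounds[of z] by (intro le_less_trans[OF _ mult_strict_left_mono]) auto
  ultimately show ?thesis
    using assms that[of i] by (simp add: circle_arc_eq)
qed

lemma circle_arc_disjoint:
  assumes "i < N" "j < N" "z \<in> circle_arc N i" "z \<in> circle_arc N j"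
  shows "i = j"
  using assms by (auto simp: circle_arc_eq)

text \<open>The half-open interval is a countable union of compact intervals, whose images under the
  continuous parametrization are compact.\<close>

lemma circle_arc_borel: "circle_arc N i \<in> sets borel"
proof -
  let ?f = "\<lambda>\<theta>. cis (2 * pi * \<theta>)" and ?a = "real i / real N" and ?b = "(real i + 1) / real N"
  have "{?a..<?b} = (\<Union>n. {?a..?b - 1 / real (Suc n)})"
  proof (intro equalityI subsetI)
    fix t assume t: "t \<in> {?a..<?b}"
    then obtain n where "1 / real (Suc n) < ?b - t"
      using nat_approx_posE[of "?b - t"] by auto
    then show "t \<in> (\<Union>n. {?a..?b - 1 / real (Suc n)})"
      using t by (auto intro!: exI[of _ n])
  next
    fix t assume "t \<in> (\<Union>n. {?a..?b - 1 / real (Suc n)})"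
    then obtain n where "?a \<le> t" "t \<le> ?b - 1 / real (Suc n)"
      by auto
    moreover have "1 / real (Suc n) > 0" by simp
    ultimately show "t \<in> {?a..<?b}"
      unfolding atLeastLessThan_iff by linarith
  qed
  then have "circle_arc N i = (\<Union>n. ?f ` {?a..?b - 1 / real (Suc n)})"
    by (simp only: circle_arc_def image_UN)
  also have "\<dots> \<in> sets borel"
    by (intro sets.countable_UN') (auto intro!: borel_closed compact_imp_closed
        compact_continuous_image continuous_intros)
  finally show ?thesis .
qed

lemma adic_arc_sets:
  assumes "N > 0"
  shows "k < N ^ n \<Longrightarrow> adic_arc N n k \<in> sets borel_circle"
proof (induction n arbitrary: k)
  case 0
  then show ?case
    by (simp add: adic_arc_0 sets_borel_circle)
next
  case (Suc n)
  have "adic_arc N n (k mod N ^ n) \<in> sets borel"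
    using Suc.IH[of "k mod N ^ n"] assms by (simp add: sets_borel_circle)
  then have "(\<lambda>z. z ^ N) -` adic_arc N n (k mod N ^ n) \<inter> space borel \<in> sets borel"
    by (rule measurable_sets[rotated]) simp
  moreover have "adic_arc N (Suc n) k \<subseteq> sphere 0 1"
    by (auto simp: adic_arc_def)
  ultimately show ?case
    using circle_arc_borel by (auto simp: sets_borel_circle adic_arc_Suc[OF assms Suc.prems])
qed

text \<open>\<open>angle\<close> is measurable for the sigma-algebra generated by the arcs, and
  composing it with the parametrization gives the identity of the circle, so each Borel set is the
  preimage of itself.\<close>

lemma borel_circle_sets_adic:
  assumes N: "N \<ge> 2" and X: "X \<in> sets borel_circle"
  shows "X \<in> sigma_sets (sphere 0 1) {adic_arc N n k |n k. k < N ^ n}" (is "_ \<in> sigma_sets _ ?A")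
proof -
  let ?M = "sigma (sphere 0 1) ?A"
  have sub: "?A \<subseteq> Pow (sphere 0 1)"
    by (auto simp: adic_arc_def)
  have "angle \<in> borel_measurable ?M"
    unfolding borel_measurable_iff_less
  proof
    fix x :: real
    \<comment> \<open>The arcs whose right endpoint is at most \<open>x\<close>.\<close>
    let ?I = "{(n, k). k < N ^ n \<and> real k + 1 \<le> real N ^ n * x}"
    have "{z \<in> space ?M. angle z < x} = (\<Union>(n, k)\<in>?I. adic_arc N n k)"
    proof (intro equalityI subsetI)
      fix z assume "z \<in> {z \<in> space ?M. angle z < x}"
      then have z: "z \<in> sphere 0 1" "angle z < x"
        using sub by (auto simp: space_measure_of)
      \<comment> \<open>\<open>N \<ge> 2\<close> makes the powers unbounded, so at some level the
        arcs are shorter than the gap between \<open>angle z\<close> and \<open>x\<close>.\<close>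
      obtain n where "1 / (x - angle z) < real N ^ n"
        using real_arch_pow[of "real N"] N by auto
      then have n: "1 < real N ^ n * (x - angle z)"
        using z by (simp add: field_simps)
      define k where "k = nat \<lfloor>real N ^ n * angle z\<rfloor>"
      have k: "real k = of_int \<lfloor>real N ^ n * angle z\<rfloor>"
        by (simp add: k_def angle_bounds)
      have k': "real k \<le> real N ^ n * angle z" "real N ^ n * angle z < real k + 1"
        unfolding k by linarith+
      have "real N ^ n * angle z < real N ^ n * 1"
        using N angle_bounds[of z] by (intro mult_strict_left_mono) auto
      then have "real k < real (N ^ n)"
        unfolding of_nat_power using k' by linarith
      then have "(n, k) \<in> ?I"
        using k' n by (auto simp: algebra_simps simp del: of_nat_power)
      moreover have "z \<in> adic_arc N n k"
        using z k' by (simp add: adic_arc_def)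
      ultimately show "z \<in> (\<Union>(n, k)\<in>?I. adic_arc N n k)"
        by blast
    next
      fix z assume "z \<in> (\<Union>(n, k)\<in>?I. adic_arc N n k)"
      then obtain n k where *: "real k + 1 \<le> real N ^ n * x" "z \<in> adic_arc N n k"
        by auto
      then have "real N ^ n * angle z < real N ^ n * x"
        by (auto simp: adic_arc_def)
      then have "angle z < x"
        using N by (simp add: mult_less_cancel_left_pos)
      then show "z \<in> {z \<in> space ?M. angle z < x}"
        using * sub by (auto simp: space_measure_of adic_arc_def)
    qed
    also have "\<dots> \<in> sets ?M"
      using sub by (intro sets.countable_UN') (auto intro: sigma_sets.Basic)
    finally show "{z \<in> space ?M. angle z < x} \<in> sets ?M" .
  qed
  moreover have "(\<lambda>\<theta>. cis (2 * pi * \<theta>)) \<in> borel_measurable borel"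
    by (intro borel_measurable_continuous_onI continuous_intros)
  ultimately have "(\<lambda>z. cis (2 * pi * angle z)) \<in> borel_measurable ?M"
    by (rule measurable_compose)
  then have "(\<lambda>z. cis (2 * pi * angle z)) -` X \<inter> space ?M \<in> sets ?M"
    by (rule measurable_sets) (use X in \<open>simp add: sets_borel_circle\<close>)
  also have "(\<lambda>z. cis (2 * pi * angle z)) -` X \<inter> space ?M = X"
    using X sub by (auto simp: sets_borel_circle space_measure_of cis_angle subset_eq)
  finally show ?thesis
    using sub by simp
qed

section \<open>Multiplication operators\<close>

lemma l2_fun_abs: "square_integrable f \<Longrightarrow> AE z in haar_circle. l2_fun (abs_l2_circle f) z = f z"
  using Quotient3_rep_abs[OF Quotient3_l2_circle, of f] by (simp add: l2_fun_def)

lemma l2_fun_measurable [measurable]: "l2_fun \<xi> \<in> borel_measurable haar_circle"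
  using square_integrable_l2_fun by (simp add: square_integrable_def)

lemma cinner_l2_circle_eq: "cinner \<xi> \<eta> = (\<integral>z. cnj (l2_fun \<xi> z) * l2_fun \<eta> z \<partial>haar_circle)"
  by (simp add: cinner_l2_circle_def l2_fun_def)

lemma integrable_cinner_l2_circle:
  "integrable haar_circle (\<lambda>z. cnj (l2_fun \<xi> z) * l2_fun \<eta> z)"
  by (intro integrable_cnj_mult square_integrable_l2_fun)

lemma l2_fun_add: "AE z in haar_circle. l2_fun (\<xi> + \<eta>) z = l2_fun \<xi> z + l2_fun \<eta> z"
  using l2_fun_abs[OF square_integrable_add[OF square_integrable_l2_fun square_integrable_l2_fun], of \<xi> \<eta>]
  by (simp add: plus_l2_circle_def l2_fun_def)

lemma l2_fun_scaleC: "AE z in haar_circle. l2_fun (c *\<^sub>C \<xi>) z = c * l2_fun \<xi> z"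
  using l2_fun_abs[OF square_integrable_cmult[OF square_integrable_l2_fun], of c \<xi>]
  by (simp add: scaleC_l2_circle_def l2_fun_def)

lemma l2_fun_zero: "AE z in haar_circle. l2_fun 0 z = 0"
  using l2_fun_abs[OF square_integrable_zero] by (simp add: zero_l2_circle_def)

lemma l2_fun_sum:
  "finite I \<Longrightarrow> AE z in haar_circle. l2_fun (\<Sum>i\<in>I. \<xi> i) z = (\<Sum>i\<in>I. l2_fun (\<xi> i) z)"
proof (induction I rule: finite_induct)
  case empty
  then show ?case using l2_fun_zero by simp
next
  case (insert j I)
  from insert.IH l2_fun_add[of "\<xi> j" "\<Sum>i\<in>I. \<xi> i"] show ?case
    by eventually_elim (simp add: insert.hyps)
qed

lemma square_integrable_one: "square_integrable (\<lambda>z. 1)"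
  using finite_measure.integrable_const[OF finite_measure_haar_circle]
  by (simp add: square_integrable_def)

definition l2_one :: l2_circle where
  "l2_one = abs_l2_circle (\<lambda>z. 1)"

lemma l2_fun_one: "AE z in haar_circle. l2_fun l2_one z = 1"
  unfolding l2_one_def by (intro l2_fun_abs square_integrable_one)

text \<open>Meaningful when products with \<open>D\<close> stay square integrable, as they do for
  circle-valued \<open>D\<close>.\<close>

definition l2_mult :: "(complex \<Rightarrow> complex) \<Rightarrow> l2_circle \<Rightarrow> l2_circle" where
  "l2_mult D \<xi> = abs_l2_circle (\<lambda>z. D z * l2_fun \<xi> z)"

lemma norm_circle_valued: "D \<in> borel_circle \<rightarrow>\<^sub>M borel_circle \<Longrightarrow> cmod z = 1 \<Longrightarrow> cmod (D z) = 1"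
  using measurable_space[of D borel_circle borel_circle z] by (simp add: space_restrict_space)

lemma circle_valued_measurable:
  assumes "D \<in> borel_circle \<rightarrow>\<^sub>M borel_circle"
  shows "D \<in> borel_measurable haar_circle"
proof -
  have "D \<in> borel_measurable borel_circle"
    using assms by (simp add: measurable_restrict_space2_iff)
  then show ?thesis
    by (simp cong: measurable_cong_sets)
qed

context
  fixes D :: "complex \<Rightarrow> complex"
  assumes D: "D \<in> borel_circle \<rightarrow>\<^sub>M borel_circle"
begin

lemma square_integrable_circle_valued_mult:
  assumes "square_integrable f"
  shows "square_integrable (\<lambda>z. D z * f z)"
proof -
  have [measurable]: "D \<in> borel_measurable haar_circle" "f \<in> borel_measurable haar_circle"
    using circle_valued_measurable[OF D] assms by (auto simp: square_integrable_def)
  have "integrable haar_circle (\<lambda>z. (cmod (D z * f z))\<^sup>2) \<longleftrightarrow> integrable haar_circle (\<lambda>z. (cmod (f z))\<^sup>2)"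
    by (rule Bochner_Integration.integrable_cong) (auto simp: norm_mult norm_circle_valued[OF D])
  then show ?thesis
    using assms by (simp add: square_integrable_def)
qed

lemma l2_fun_mult: "AE z in haar_circle. l2_fun (l2_mult D \<xi>) z = D z * l2_fun \<xi> z"
  unfolding l2_mult_def
  by (intro l2_fun_abs square_integrable_circle_valued_mult square_integrable_l2_fun)

lemma cinner_l2_mult: "cinner (l2_mult D \<xi>) (l2_mult D \<eta>) = cinner \<xi> \<eta>"
  unfolding cinner_l2_circle_eq
proof (rule integral_cong_AE)
  have 1: "cnj (D z) * D z = 1" if "z \<in> space haar_circle" for z
    using norm_circle_valued[OF D, of z] that by (simp add: mult.commute flip: complex_norm_square)
  show "AE z in haar_circle. cnj (l2_fun (l2_mult D \<xi>) z) * l2_fun (l2_mult D \<eta>) z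
      = cnj (l2_fun \<xi> z) * l2_fun \<eta> z"
    using l2_fun_mult[of \<xi>] l2_fun_mult[of \<eta>] AE_space
  proof eventually_elim
    case (elim z)
    have "cnj (l2_fun (l2_mult D \<xi>) z) * l2_fun (l2_mult D \<eta>) z
        = (cnj (D z) * D z) * (cnj (l2_fun \<xi> z) * l2_fun \<eta> z)"
      by (simp add: elim)
    then show ?case
      by (simp only: 1[OF elim(3)] mult_1_left)
  qed
qed (rule borel_measurable_integrable[OF integrable_cinner_l2_circle])+

lemma bounded_clinear_l2_mult: "bounded_clinear (l2_mult D)"
proof -
  have add: "l2_mult D (\<xi> + \<eta>) = l2_mult D \<xi> + l2_mult D \<eta>" for \<xi> \<eta>
    unfolding l2_fun_eq_iff
    using l2_fun_mult[of \<xi>] l2_fun_mult[of \<eta>] l2_fun_mult[of "\<xi> + \<eta>"] l2_fun_add[of \<xi> \<eta>]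
      l2_fun_add[of "l2_mult D \<xi>" "l2_mult D \<eta>"]
    by eventually_elim (simp add: distrib_left)
  have scale: "l2_mult D (c *\<^sub>C \<xi>) = c *\<^sub>C l2_mult D \<xi>" for c \<xi>
    unfolding l2_fun_eq_iff
    using l2_fun_mult[of \<xi>] l2_fun_mult[of "c *\<^sub>C \<xi>"] l2_fun_scaleC[of c \<xi>]
      l2_fun_scaleC[of c "l2_mult D \<xi>"]
    by eventually_elim simp
  have "norm (l2_mult D \<xi>) = norm \<xi>" for \<xi>
    by (simp add: norm_eq_sqrt_inner inner_eq_Re_cinner cinner_l2_mult)
  then have "bounded_linear (l2_mult D)"
    by (intro bounded_linear_intro[where K = 1]) (simp_all add: add scale scaleR_scaleC)
  then show ?thesis
    by (simp add: bounded_clinear_def scale)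
qed

end

text \<open>The inverse is multiplication by the complex conjugate, since \<open>D\<close> is
  unimodular at every point of the circle.\<close>

lemma unitary_l2_mult:
  assumes D: "D \<in> borel_circle \<rightarrow>\<^sub>M borel_circle"
  shows "unitary (l2_mult D)"
proof -
  have "(\<lambda>z. cnj (D z)) \<in> borel_measurable borel_circle"
    using D by (intro borel_measurable_continuous_on[of cnj] continuous_intros)
      (simp add: measurable_restrict_space2_iff)
  then have D': "(\<lambda>z. cnj (D z)) \<in> borel_circle \<rightarrow>\<^sub>M borel_circle"
    using norm_circle_valued[OF D]
    by (intro measurable_restrict_space2) (auto simp: space_restrict_space)
  have 1: "cnj (D z) * D z = 1" if "z \<in> space haar_circle" for z
    using norm_circle_valued[OF D, of z] that by (simp add: mult.commute flip: complex_norm_square)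
  have "l2_mult (\<lambda>z. cnj (D z)) (l2_mult D \<xi>) = \<xi>" for \<xi>
    unfolding l2_fun_eq_iff
    using l2_fun_mult[OF D', of "l2_mult D \<xi>"] l2_fun_mult[OF D, of \<xi>] AE_space
    by eventually_elim (simp add: 1 flip: mult.assoc)
  moreover have "l2_mult D (l2_mult (\<lambda>z. cnj (D z)) \<xi>) = \<xi>" for \<xi>
    unfolding l2_fun_eq_iff
    using l2_fun_mult[OF D, of "l2_mult (\<lambda>z. cnj (D z)) \<xi>"] l2_fun_mult[OF D', of \<xi>] AE_space
    by eventually_elim (simp add: 1 mult.commute[of "D _"] flip: mult.assoc)
  ultimately have "bij (l2_mult D)"
    by (intro o_bij[of "l2_mult (\<lambda>z. cnj (D z))"]) (auto simp: fun_eq_iff)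
  then show ?thesis
    by (simp add: unitary_def bounded_clinear_l2_mult D cinner_l2_mult)
qed

section \<open>Indicator functions in the image of the Cuntz algebra\<close>

text \<open>The algebra element is a parameter so that the same \<open>a\<close> can serve for two
  representations.\<close>

definition acts_as_indicator :: "('a \<Rightarrow> l2_circle \<Rightarrow> l2_circle) \<Rightarrow> complex set \<Rightarrow> 'a \<Rightarrow> bool" where
  "acts_as_indicator \<pi> X a \<longleftrightarrow>
     (\<forall>\<xi>. AE z in haar_circle. l2_fun (\<pi> a \<xi>) z = indicator X z * l2_fun \<xi> z)"

lemma cinner_acts_as_indicator:
  assumes a: "acts_as_indicator \<pi> X a" and X: "X \<in> sets haar_circle"
  shows "cinner (\<pi> a \<xi>) \<eta> = (\<integral>z. indicator X z * (cnj (l2_fun \<xi> z) * l2_fun \<eta> z) \<partial>haar_circle)"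
  unfolding cinner_l2_circle_eq
proof (rule integral_cong_AE)
  show "AE z in haar_circle. cnj (l2_fun (\<pi> a \<xi>) z) * l2_fun \<eta> z
      = indicator X z * (cnj (l2_fun \<xi> z) * l2_fun \<eta> z)"
    using a[unfolded acts_as_indicator_def, rule_format, of \<xi>]
    by eventually_elim (simp add: indicator_def)
  show "(\<lambda>z. indicator X z * (cnj (l2_fun \<xi> z) * l2_fun \<eta> z)) \<in> borel_measurable haar_circle"
    by (intro borel_measurable_times borel_measurable_indicator X
        borel_measurable_integrable[OF integrable_cinner_l2_circle])
qed (rule borel_measurable_integrable[OF integrable_cinner_l2_circle])

context
  fixes N :: nat and s :: "nat \<Rightarrow> 'a::cstar_algebra" and u :: "complex \<Rightarrow> complex"
    and \<pi> :: "'a \<Rightarrow> l2_circle \<Rightarrow> l2_circle"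
  assumes N: "N > 0" and cuntz: "cuntz_algebra N s" and \<pi>: "is_pi_rep N s u \<pi>"
begin

lemma is_pi_rep_star: "star_representation \<pi>"
  using \<pi> by (simp add: is_pi_rep_def)

lemma is_pi_rep_generator:
  "i < N \<Longrightarrow> AE z in haar_circle. l2_fun (\<pi> (s i) \<xi>) z =
    complex_of_real (sqrt (real N)) * indicator (circle_arc N i) z * u z * l2_fun \<xi> (z ^ N)"
  using \<pi> by (simp add: is_pi_rep_def)

text \<open>The ranges of the \<open>s i\<close> are orthogonal, sum up to the identity, and consist of functions
  supported in the corresponding arcs, so the range projections cut down to these arcs.\<close>

lemma acts_as_indicator_range_projection:
  assumes i: "i < N"
  shows "acts_as_indicator \<pi> (circle_arc N i) (s i * adj (s i))"
  unfolding acts_as_indicator_def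
proof
  fix \<xi>
  let ?p = "\<lambda>j. \<pi> (s j * adj (s j)) \<xi>"
  have "\<xi> = \<pi> (\<Sum>j<N. s j * adj (s j)) \<xi>"
    using cuntz star_representation_one[OF is_pi_rep_star] by (simp add: cuntz_algebra_def)
  also have "\<dots> = (\<Sum>j<N. ?p j)"
    by (rule star_representation_sum[OF is_pi_rep_star])
  finally have \<xi>: "\<xi> = (\<Sum>j<N. ?p j)" .
  have "AE z in haar_circle. l2_fun \<xi> z = (\<Sum>j<N. l2_fun (?p j) z)"
    using l2_fun_sum[of "{..<N}" ?p] unfolding \<xi>[symmetric] by simp
  \<comment> \<open>Component \<open>j\<close> lies in the range of \<open>s j\<close>, and the
    formula for that generator carries the indicator of arc \<open>j\<close>.\<close>
  moreover have "AE z in haar_circle. \<forall>j\<in>{..<N}. z \<notin> circle_arc N j \<longrightarrow> l2_fun (?p j) z = 0"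
  proof (intro AE_finite_allI)
    fix j assume "j \<in> {..<N}"
    then have "j < N" by simp
    from is_pi_rep_generator[OF this, of "\<pi> (adj (s j)) \<xi>"]
    show "AE z in haar_circle. z \<notin> circle_arc N j \<longrightarrow> l2_fun (?p j) z = 0"
      by eventually_elim (simp add: star_representation_mult[OF is_pi_rep_star])
  qed simp
  ultimately show "AE z in haar_circle. l2_fun (?p i) z = indicator (circle_arc N i) z * l2_fun \<xi> z"
  proof eventually_elim
    case (elim z)
    show ?case
    proof (cases "z \<in> circle_arc N i")
      case True
      have "(\<Sum>j<N. l2_fun (?p j) z) = (\<Sum>j\<in>{i}. l2_fun (?p j) z)"
      proof (rule sum.mono_neutral_right)
        show "\<forall>j\<in>{..<N} - {i}. l2_fun (?p j) z = 0"
          using elim(2) circle_arc_disjoint[OF i _ True] by blast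
      qed (use i in auto)
      then show ?thesis
        using True elim(1) by simp
    next
      case False
      then show ?thesis using elim(2) i by simp
    qed
  qed
qed

text \<open>Applying \<open>s i\<close> to \<open>\<pi> (adj (s i)) \<xi>\<close> gives
  \<open>\<xi>\<close> cut down to the arc; cutting down to \<open>X\<close> in between inserts the
  indicator of \<open>X\<close> at \<open>z ^ N\<close>. Iteration prepends digits, as in the
  recursion for N-adic arcs.\<close>

lemma acts_as_indicator_pullback:
  assumes i: "i < N" and a: "acts_as_indicator \<pi> X a"
  shows "acts_as_indicator \<pi> (circle_arc N i \<inter> (\<lambda>z. z ^ N) -` X) (s i * a * adj (s i))"
  unfolding acts_as_indicator_def
proof
  fix \<xi>
  define \<eta> where "\<eta> = \<pi> (adj (s i)) \<xi>"
  have "AE z in haar_circle. l2_fun (\<pi> a \<eta>) z = indicator X z * l2_fun \<eta> z"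
    using a by (simp add: acts_as_indicator_def)
  from AE_haar_circle_power[OF N this]
    is_pi_rep_generator[OF i, of "\<pi> a \<eta>"] is_pi_rep_generator[OF i, of \<eta>]
    acts_as_indicator_range_projection[OF i, unfolded acts_as_indicator_def, rule_format, of \<xi>]
  show "AE z in haar_circle. l2_fun (\<pi> (s i * a * adj (s i)) \<xi>) z =
      indicator (circle_arc N i \<inter> (\<lambda>z. z ^ N) -` X) z * l2_fun \<xi> z"
    by eventually_elim
      (auto simp: star_representation_mult[OF is_pi_rep_star] \<eta>_def[symmetric] indicator_def
        simp flip: mult.assoc)
qed

lemma acts_as_indicator_mult:
  assumes a: "acts_as_indicator \<pi> X a" and b: "acts_as_indicator \<pi> Y b"
  shows "acts_as_indicator \<pi> (X \<inter> Y) (a * b)"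
  unfolding acts_as_indicator_def
proof
  fix \<xi>
  from a[unfolded acts_as_indicator_def, rule_format, of "\<pi> b \<xi>"]
    b[unfolded acts_as_indicator_def, rule_format, of \<xi>]
  show "AE z in haar_circle. l2_fun (\<pi> (a * b) \<xi>) z = indicator (X \<inter> Y) z * l2_fun \<xi> z"
    by eventually_elim (simp add: star_representation_mult[OF is_pi_rep_star] indicator_def)
qed

lemma acts_as_indicator_one: "acts_as_indicator \<pi> (sphere 0 1) 1"
  unfolding acts_as_indicator_def star_representation_one[OF is_pi_rep_star]
  using AE_space by (auto simp: indicator_def elim!: eventually_mono)

end

section \<open>Intertwiners and coboundaries\<close>

context
  fixes N :: nat and s :: "nat \<Rightarrow> 'a::cstar_algebra" and u u' :: "complex \<Rightarrow> complex"
    and \<pi> \<pi>' :: "'a \<Rightarrow> l2_circle \<Rightarrow> l2_circle"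
  assumes N: "N \<ge> 2" and cuntz: "cuntz_algebra N s"
    and \<pi>: "is_pi_rep N s u \<pi>" and \<pi>': "is_pi_rep N s u' \<pi>'"
begin

lemma cnj_mult_intertwiner:
  assumes W: "unitary W" and W\<pi>: "\<And>a x. W (\<pi> a x) = \<pi>' a (W x)"
  shows "AE z in haar_circle.
    cnj (l2_fun (W \<xi>) z) * l2_fun (W \<eta>) z = cnj (l2_fun \<xi> z) * l2_fun \<eta> z"
proof -
  have "N > 0" using N by simp
  note rep = this cuntz \<pi> and rep' = this cuntz \<pi>'
  let ?h = "\<lambda>z. cnj (l2_fun (W \<xi>) z) * l2_fun (W \<eta>) z - cnj (l2_fun \<xi> z) * l2_fun \<eta> z"
  \<comment> \<open>Sets cut out in both representations by one common algebra element; products of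
    such elements give intersections of the sets.\<close>
  let ?E = "{X \<in> sets haar_circle. \<exists>a. acts_as_indicator \<pi> X a \<and> acts_as_indicator \<pi>' X a}"
  have h: "integrable haar_circle ?h"
    by (intro Bochner_Integration.integrable_diff integrable_cinner_l2_circle)
  have stable: "Int_stable ?E"
    using acts_as_indicator_mult[OF rep] acts_as_indicator_mult[OF rep']
    by (intro Int_stableI) blast
  have sphere: "sphere 0 1 \<in> ?E"
    using acts_as_indicator_one[OF rep] acts_as_indicator_one[OF rep']
    by (auto simp: sets_borel_circle)
  \<comment> \<open>Induction on the number of digits: passing from \<open>a\<close> to
    \<open>s i * a * adj (s i)\<close> prepends the digit \<open>i\<close> in both representations
    at once.\<close>
  have arcs: "adic_arc N n k \<in> ?E" if "k < N ^ n" for n k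
    using that
  proof (induction n arbitrary: k)
    case 0
    then show ?case using sphere by (simp add: adic_arc_0)
  next
    case (Suc n)
    have "k mod N ^ n < N ^ n" and "k div N ^ n < N"
      using \<open>N > 0\<close> Suc.prems by (auto simp: less_mult_imp_div_less)
    then show ?case
      using Suc.IH[of "k mod N ^ n"] adic_arc_sets[OF \<open>N > 0\<close> Suc.prems]
        acts_as_indicator_pullback[OF rep] acts_as_indicator_pullback[OF rep']
      unfolding adic_arc_Suc[OF \<open>N > 0\<close> Suc.prems] by fastforce
  qed
  have "(\<integral>z. indicator X z * ?h z \<partial>haar_circle) = 0" if "X \<in> ?E" for X
  proof -
    from that obtain a where X: "X \<in> sets haar_circle"
      and a: "acts_as_indicator \<pi> X a" "acts_as_indicator \<pi>' X a"
      by auto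
    have i: "integrable haar_circle (\<lambda>z. indicator X z * (cnj (l2_fun \<xi> z) * l2_fun \<eta> z))" for \<xi> \<eta>
      using integrable_mult_indicator[OF X integrable_cinner_l2_circle[of \<xi> \<eta>]]
      by (rule back_subst[where P = "integrable haar_circle"])
        (rule ext, simp add: indicator_def)
    \<comment> \<open>Intertwining moves \<open>W\<close> in front of \<open>\<pi> a \<xi>\<close>,
      and isometry then removes it from both arguments.\<close>
    have "cinner (\<pi>' a (W \<xi>)) (W \<eta>) = cinner (\<pi> a \<xi>) \<eta>"
      using W by (simp add: unitary_def flip: W\<pi>)
    then have "(\<integral>z. indicator X z * (cnj (l2_fun (W \<xi>) z) * l2_fun (W \<eta>) z) \<partial>haar_circle)
        = (\<integral>z. indicator X z * (cnj (l2_fun \<xi> z) * l2_fun \<eta> z) \<partial>haar_circle)"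
      by (simp only: cinner_acts_as_indicator[OF a(1) X] cinner_acts_as_indicator[OF a(2) X])
    then show ?thesis
      by (simp only: right_diff_distrib Bochner_Integration.integral_diff[OF i i] diff_self)
  qed
  note E0 = this
  have "(\<integral>z. indicator X z * ?h z \<partial>haar_circle) = 0" if "X \<in> sets haar_circle" for X
  proof (rule integral_zero_sigma_sets[OF h stable _ _ E0])
    have "X \<in> sigma_sets (sphere 0 1) {adic_arc N n k |n k. k < N ^ n}"
      using that by (intro borel_circle_sets_adic[OF N]) simp
    also have "\<dots> \<subseteq> sigma_sets (sphere 0 1) ?E"
      by (intro sigma_sets_mono') (use arcs in blast)
    finally show "X \<in> sigma_sets (space haar_circle) ?E" by simp
  qed (use sphere in auto)
  then have "AE z in haar_circle. ?h z = 0"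
    by (rule AE_eq_0_if_set_integral_0[OF h])
  then show ?thesis by simp
qed

lemma unitarily_equivalent_imp_cobound:
  assumes "unitarily_equivalent \<pi> \<pi>'"
  shows "cobound N u u'"
proof -
  have "N > 0" using N by simp
  note rep = this cuntz \<pi> and rep' = this cuntz \<pi>'
  from assms obtain W where W: "unitary W" and W\<pi>: "\<And>a x. W (\<pi> a x) = \<pi>' a (W x)"
    by (auto simp: unitarily_equivalent_def)
  define D where "D = l2_fun (W l2_one)"
  have unimod: "AE z in haar_circle. cmod (D z) = 1"
    using cnj_mult_intertwiner[OF W W\<pi>, of l2_one l2_one] l2_fun_one
  proof eventually_elim
    case (elim z)
    then have "complex_of_real ((cmod (D z))\<^sup>2) = 1"
      unfolding D_def complex_norm_square by (simp add: mult.commute)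
    then have "(cmod (D z))\<^sup>2 = 1"
      by (simp only: of_real_eq_1_iff)
    then show ?case
      by (simp add: power2_eq_1_iff) (use norm_ge_zero[of "D z"] in linarith)
  qed
  \<comment> \<open>Pairing with the constant 1 gives
    \<open>cnj (D z) * l2_fun (W \<xi>) z = l2_fun \<xi> z\<close>; multiplying by the unimodular
    \<open>D z\<close> isolates \<open>W \<xi>\<close>.\<close>
  have W_eq: "AE z in haar_circle. l2_fun (W \<xi>) z = D z * l2_fun \<xi> z" for \<xi>
    using cnj_mult_intertwiner[OF W W\<pi>, of l2_one \<xi>] l2_fun_one unimod
  proof eventually_elim
    case (elim z)
    have "D z * cnj (D z) = 1"
      using elim(3) by (simp flip: complex_norm_square)
    moreover have "cnj (D z) * l2_fun (W \<xi>) z = l2_fun \<xi> z"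
      using elim by (simp add: D_def)
    ultimately show ?case
      by (metis mult.assoc mult_1_left)
  qed
  \<comment> \<open>\<open>D\<close> is unimodular only almost everywhere, while
    \<open>cobound\<close> asks for a map of the whole circle into itself; the default 1 fills the
    exceptional set.\<close>
  define \<Delta> where "\<Delta> z = (if cmod (D z) = 1 then D z else 1)" for z
  have "D \<in> borel_measurable borel_circle"
    using l2_fun_measurable[of "W l2_one"] by (simp add: D_def cong: measurable_cong_sets)
  then have "\<Delta> \<in> borel_measurable borel_circle"
    unfolding \<Delta>_def by measurable
  then have "\<Delta> \<in> borel_circle \<rightarrow>\<^sub>M borel_circle"
    by (intro measurable_restrict_space2) (auto simp: \<Delta>_def)
  moreover have "AE z in haar_circle. \<Delta> z * u z = u' z * \<Delta> (z ^ N)"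
  proof -
    \<comment> \<open>Intertwining of \<open>s i\<close>, evaluated at the constant 1, gives
      information only on arc \<open>i\<close>; there the factor \<open>sqrt (real N)\<close> is
      nonzero and cancels.\<close>
    have "AE z in haar_circle. \<forall>i\<in>{..<N}. z \<in> circle_arc N i \<longrightarrow> D z * u z = u' z * D (z ^ N)"
    proof (intro AE_finite_allI)
      fix i assume "i \<in> {..<N}"
      then have i: "i < N" by simp
      show "AE z in haar_circle. z \<in> circle_arc N i \<longrightarrow> D z * u z = u' z * D (z ^ N)"
        using W_eq[of "\<pi> (s i) l2_one"] is_pi_rep_generator[OF rep i, of l2_one]
          is_pi_rep_generator[OF rep' i, of "W l2_one"] AE_haar_circle_power[OF \<open>N > 0\<close> l2_fun_one]
      proof eventually_elim
        case (elim z)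
        then show ?case
          using \<open>N > 0\<close> by (auto simp: W\<pi> D_def[symmetric])
      qed
    qed simp
    \<comment> \<open>For almost all \<open>z\<close>, \<open>\<Delta>\<close> agrees with
      \<open>D\<close> at both \<open>z\<close> and \<open>z ^ N\<close>, and some arc contains
      \<open>z\<close>.\<close>
    with unimod AE_haar_circle_power[OF \<open>N > 0\<close> unimod] AE_space show ?thesis
    proof eventually_elim
      case (elim z)
      then obtain i where "i < N" "z \<in> circle_arc N i"
        using circle_arc_cover[OF \<open>N > 0\<close>, of z] by auto
      then have "D z * u z = u' z * D (z ^ N)"
        using elim(4) by blast
      with elim show ?case
        by (simp add: \<Delta>_def)
    qed
  qed
  ultimately show ?thesis
    by (auto simp: cobound_def)
qed

lemma cobound_imp_unitarily_equivalent:
  assumes "cobound N u u'"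
  shows "unitarily_equivalent \<pi> \<pi>'"
proof -
  have "N > 0" using N by simp
  note rep = this cuntz \<pi> and rep' = this cuntz \<pi>'
  from assms obtain \<Delta> where \<Delta>: "\<Delta> \<in> borel_circle \<rightarrow>\<^sub>M borel_circle"
    and eq: "AE z in haar_circle. \<Delta> z * u z = u' z * \<Delta> (z ^ N)"
    by (auto simp: cobound_def)
  \<comment> \<open>Both sides share the factor \<open>?c\<close> below; what remains is the
    cobounding equation. The value of \<open>l2_mult \<Delta> \<xi>\<close> is needed at
    \<open>z ^ N\<close>, hence the transport along the power map.\<close>
  have "l2_mult \<Delta> (\<pi> (s i) \<xi>) = \<pi>' (s i) (l2_mult \<Delta> \<xi>)" if i: "i < N" for i \<xi>
    unfolding l2_fun_eq_iff
    using l2_fun_mult[OF \<Delta>, of "\<pi> (s i) \<xi>"] is_pi_rep_generator[OF rep i, of \<xi>]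
      is_pi_rep_generator[OF rep' i, of "l2_mult \<Delta> \<xi>"]
      AE_haar_circle_power[OF \<open>N > 0\<close> l2_fun_mult[OF \<Delta>, of \<xi>]] eq
  proof eventually_elim
    case (elim z)
    let ?c = "complex_of_real (sqrt (real N)) * indicator (circle_arc N i) z * l2_fun \<xi> (z ^ N)"
    have "l2_fun (l2_mult \<Delta> (\<pi> (s i) \<xi>)) z = (\<Delta> z * u z) * ?c"
      by (simp only: elim(1,2) ac_simps)
    also have "\<dots> = (u' z * \<Delta> (z ^ N)) * ?c"
      by (simp only: elim(5))
    also have "\<dots> = l2_fun (\<pi>' (s i) (l2_mult \<Delta> \<xi>)) z"
      by (simp only: elim(3,4) ac_simps)
    finally show ?case .
  qed
  then have gen: "l2_mult \<Delta> (\<pi> g \<xi>) = \<pi>' g (l2_mult \<Delta> \<xi>)" if "g \<in> s ` {..<N}" for g \<xi>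
    using that by auto
  have "cstar_subalgebra hull (s ` {..<N}) = UNIV"
    using cuntz by (simp add: cuntz_algebra_def)
  then have "l2_mult \<Delta> (\<pi> a \<xi>) = \<pi>' a (l2_mult \<Delta> \<xi>)" for a \<xi>
    using gen by (rule unitary_intertwines_generated[OF is_pi_rep_star[OF rep]
          is_pi_rep_star[OF rep'] unitary_l2_mult[OF \<Delta>]])
  then show ?thesis
    using unitary_l2_mult[OF \<Delta>] by (auto simp: unitarily_equivalent_def)
qed

end

theorem corollary8p3:
  fixes N :: nat
    and s :: "nat \<Rightarrow> 'a::cstar_algebra"
    and u u' :: "complex \<Rightarrow> complex"
    and \<pi> \<pi>' :: "'a \<Rightarrow> l2_circle \<Rightarrow> l2_circle"
  assumes "N \<ge> 2"
    and "cuntz_algebra N s"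
    and "u \<in> borel_circle \<rightarrow>\<^sub>M borel_circle"
    and "u' \<in> borel_circle \<rightarrow>\<^sub>M borel_circle"
    and "is_pi_rep N s u \<pi>"
    and "is_pi_rep N s u' \<pi>'"
  shows "unitarily_equivalent \<pi> \<pi>' \<longleftrightarrow> cobound N u u'"
  using unitarily_equivalent_imp_cobound[OF assms(1,2,5,6)]
    cobound_imp_unitarily_equivalent[OF assms(1,2,5,6)] ..

end
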